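(* Consider the regularized MPC closed loop described in the context. Assume that $D$ is positive definite and that the regularizer has the form $V_{\mathrm{reg}}(U,t)=\sum_{h=1}^{H}\ell_{\mathrm{reg}}(u_h,t+h)$, where $\ell_{\mathrm{reg}}(\cdot,t):\mathbb{R}^m\to\mathbb{R}\cup\{+\infty\}$ is convex, closed and proper for each $t\in\mathbb{N}$. Let $\eta\in(0,1)$. If there exist a positive definite matrix $P\in\mathbb{R}^{n\times n}$ and nonnegative scalars $\lambda_1,\dots,\lambda_H$ satisfying $$ \begin{bmatrix} A^\top P A-\eta^2 P & A^\top P B\Pi_1\\ \Pi_1^\top B^\top P A & \Pi_1^\top B^\top P B\Pi_1\end{bmatrix} +\begin{bmatrix}0 & I_{Hm}\\ -C & -D\end{bmatrix}^\top \begin{bmatrix}0&\Lambda\\ \Lambda&0\end{bmatrix} \begin{bmatrix}0 & I_{Hm}\\ -C & -D\end{bmatrix}\preceq 0, $$ where $\Lambda:=\mathrm{diag}(\lambda_1,\dots,\lambda_H)\otimes I_m$, then the closed-loop system is strongly contracting with respect to the norm $\|\cdot\|_P$ with factor $\eta$.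
   Context: Plant: $x(t+1)=Ax(t)+Bu(t)$, $t\in\mathbb{N}=\{0,1,2,\dots\}$, with $A\in\mathbb{R}^{n\times n}$, $B\in\mathbb{R}^{n\times m}$. Let $H\ge 1$ be an integer (prediction horizon), and let $Q,Q_{\mathrm f}\in\mathbb{R}^{n\times n}$, $R\in\mathbb{R}^{m\times m}$ be symmetric cost matrices; write $\|v\|_Q^2=v^\top Qv$ (similarly for the others). For a state $x$ and time $t$, the optimal control problem (OCP) is: minimize over $U=[u_1;\dots;u_H]\in\mathbb{R}^{Hm}$ (each $u_h\in\mathbb{R}^m$) $$\tfrac12\sum_{h=1}^{H}(\|x_h\|_Q^2+\|u_h\|_R^2)+\tfrac12\|x_{H+1}\|_{Q_{\mathrm f}}^2+V_{\mathrm{reg}}(X,U,t),$$ where $x_1=x$, $x_{h+1}=Ax_h+Bu_h$ for $h=1,\dots,H$, and $X=[x_2;\dots;x_{H+1}]\in\mathbb{R}^{Hn}$; here the regularizer $V_{\mathrm{reg}}$ depends only on $U,t$. Define $\bar A:=[A;A^2;\dots;A^H]\in\mathbb{R}^{Hn\times n}$ (vertical stacking); $\bar B\in\mathbb{R}^{Hn\times Hm}$ the block lower triangular matrix whose $(i,j)$ block is $A^{i-j}B$ for $i\ge j$ and $0$ for $i<j$; $\bar Q:=\mathrm{diag}(Q,\dots,Q,Q_{\mathrm f})$ with $H-1$ copies of $Q$; $\bar R:=\mathrm{diag}(R,\dots,R)$ with $H$ copies; $C:=\bar B^\top\bar Q\bar A$; $D:=\bar R+\bar B^\top\bar Q\bar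 B$. Up to terms independent of $U$, the OCP is $\min_U\ U^\top Cx+\tfrac12U^\top DU+V_{\mathrm{reg}}(\bar Ax+\bar BU,U,t)$. Let $U_t^\ast(x)$ be the optimal solution (unique under the stated assumptions) and $\Pi_1=[I_m\ 0]\in\mathbb{R}^{m\times Hm}$. The regularized MPC feedback is $u(t)=\Pi_1U_t^\ast(x(t))$; the closed loop is $x(t+1)=Ax(t)+B\Pi_1U^\ast_t(x(t))$. A system $x(t+1)=f_t(x(t))$ is strongly contracting with respect to $\|\cdot\|_P$ ($\|v\|_P=\sqrt{v^\top Pv}$, $P$ positive definite) with factor $\eta\in(0,1)$ if any two trajectories satisfy $\|x^{(1)}(t+1)-x^{(2)}(t+1)\|_P\le\eta\|x^{(1)}(t)-x^{(2)}(t)\|_P$ for all $t\in\mathbb{N}$. Positive definite matrices are symmetric; $\otimes$ is the Kronecker product. *)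

theory Defs
  imports "HOL-Analysis.Analysis"
begin

section \<open>Matrices\<close>

text \<open>The power \<open>A ^ k\<close> of the library is componentwise on \<open>real ^ 'n ^ 'n\<close>, hence the
  following matrix power.\<close>

primrec mat_power :: "real ^ 'n ^ 'n \<Rightarrow> nat \<Rightarrow> real ^ 'n ^ 'n" where
  "mat_power A 0 = mat 1"
| "mat_power A (Suc k) = A ** mat_power A k"

definition quad_form :: "real ^ 'n ^ 'n \<Rightarrow> real ^ 'n \<Rightarrow> real" where
  "quad_form M v = v \<bullet> (M *v v)"

definition symmetric_mat :: "real ^ 'n ^ 'n \<Rightarrow> bool" where
  "symmetric_mat M \<longleftrightarrow> transpose M = M"

definition pos_def_mat :: "real ^ 'n ^ 'n \<Rightarrow> bool" where
  "pos_def_mat M \<longleftrightarrow> symmetric_mat M \<and> (\<forall>v. v \<noteq> 0 \<longrightarrow> 0 < quad_form M v)"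

definition neg_semidef_mat :: "real ^ 'n ^ 'n \<Rightarrow> bool" where
  "neg_semidef_mat M \<longleftrightarrow> symmetric_mat M \<and> (\<forall>v. quad_form M v \<le> 0)"

definition weighted_norm :: "real ^ 'n ^ 'n \<Rightarrow> real ^ 'n \<Rightarrow> real" where
  "weighted_norm P v = sqrt (quad_form P v)"

definition block_mat ::
  "real ^ 'c ^ 'r \<Rightarrow> real ^ 'd ^ 'r \<Rightarrow> real ^ 'c ^ 's \<Rightarrow> real ^ 'd ^ 's \<Rightarrow> real ^ ('c + 'd) ^ ('r + 's)" where
  "block_mat M11 M12 M21 M22 = (\<chi> i j.
     (case i of
        Inl a \<Rightarrow> (case j of Inl b \<Rightarrow> M11 $ a $ b | Inr b \<Rightarrow> M12 $ a $ b)
      | Inr a \<Rightarrow> (case j of Inl b \<Rightarrow> M21 $ a $ b | Inr b \<Rightarrow> M22 $ a $ b)))"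

definition diag_mat :: "real ^ 'n \<Rightarrow> real ^ 'n ^ 'n" where
  "diag_mat d = (\<chi> i j. if i = j then d $ i else 0)"

definition kronecker :: "real ^ 'b ^ 'a \<Rightarrow> real ^ 'd ^ 'c \<Rightarrow> real ^ ('b \<times> 'd) ^ ('a \<times> 'c)" where
  "kronecker M N = (\<chi> i j. M $ fst i $ fst j * N $ snd i $ snd j)"


section \<open>Prediction horizon\<close>

text \<open>The horizon is \<open>H = CARD('h)\<close> for a finite linearly ordered type \<open>'h\<close>; every
  \<open>H \<ge> 1\<close> is of this form, e.g. with the numeral types.  The function \<open>stage\<close> numbers the
  elements of \<open>'h\<close> increasingly by \<open>1, \<dots>, H\<close>, and vectors stacked from \<open>H\<close> blocks of
  length \<open>m\<close> have type \<open>real ^ ('h \<times> 'm)\<close>, with the stage as first component of the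
  index.\<close>

definition stage :: "'h::{finite,linorder} \<Rightarrow> nat" where
  "stage h = card {..h}"

definition block :: "real ^ ('h::finite \<times> 'm) \<Rightarrow> 'h \<Rightarrow> real ^ 'm" where
  "block U h = (\<chi> j. U $ (h, j))"

lemma bij_betw_stage:
  "bij_betw stage (UNIV :: 'h::{finite,linorder} set) {1..CARD('h)}"
proof -
  have less: "stage h < stage k" if "h < k" for h k :: 'h
    unfolding stage_def using that by (intro psubset_card_mono) auto
  have inj: "inj (stage :: 'h \<Rightarrow> nat)"
    by (rule injI) (metis less less_irrefl linorder_neqE)
  have "range (stage :: 'h \<Rightarrow> nat) \<subseteq> {1..CARD('h)}"
    by (auto simp: stage_def Suc_le_eq card_gt_0_iff intro!: card_mono)
  moreover have "card (range (stage :: 'h \<Rightarrow> nat)) = card {1..CARD('h)}"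
    by (simp add: card_image inj)
  ultimately have "range (stage :: 'h \<Rightarrow> nat) = {1..CARD('h)}"
    by (intro card_subset_eq) auto
  with inj show ?thesis by (simp add: bij_betw_def)
qed


section \<open>The optimal control problem\<close>

primrec plant_state ::
  "real ^ 'n ^ 'n \<Rightarrow> real ^ 'm ^ 'n \<Rightarrow> real ^ 'n \<Rightarrow> (nat \<Rightarrow> real ^ 'm) \<Rightarrow> nat \<Rightarrow> real ^ 'n" where
  "plant_state A B x u 0 = x"
| "plant_state A B x u (Suc k) = A *v plant_state A B x u k + B *v u k"

text \<open>The predicted states are \<open>x\<^sub>1 = x\<close> and \<open>x\<^sub>h\<^sub>+\<^sub>1 = A x\<^sub>h + B u\<^sub>h\<close>, where \<open>u\<^sub>h\<close> is the block of
  \<open>U\<close> at stage \<open>h\<close>, for \<open>1 \<le> h \<le> H\<close>.  The state \<open>x\<^sub>h\<close> is reached after \<open>h - 1\<close> steps of the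
  plant.\<close>

definition predicted_state ::
  "real ^ 'n ^ 'n \<Rightarrow> real ^ 'm ^ 'n \<Rightarrow> real ^ 'n \<Rightarrow> real ^ ('h::{finite,linorder} \<times> 'm) \<Rightarrow> nat \<Rightarrow> real ^ 'n" where
  "predicted_state A B x U h = plant_state A B x (\<lambda>k. block U (inv stage (k + 1))) (h - 1)"

definition ocp_cost ::
  "real ^ 'n ^ 'n \<Rightarrow> real ^ 'm ^ 'n \<Rightarrow> real ^ 'n ^ 'n \<Rightarrow> real ^ 'n ^ 'n \<Rightarrow> real ^ 'm ^ 'm \<Rightarrow>
   (real ^ ('h \<times> 'm) \<Rightarrow> nat \<Rightarrow> ereal) \<Rightarrow> nat \<Rightarrow> real ^ 'n \<Rightarrow> real ^ ('h::{finite,linorder} \<times> 'm) \<Rightarrow> ereal" where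
  "ocp_cost A B Q Qf R Vreg t x U =
     ereal ((1/2) * (\<Sum>h\<in>UNIV. quad_form Q (predicted_state A B x U (stage h))
                             + quad_form R (block U h))
            + (1/2) * quad_form Qf (predicted_state A B x U (CARD('h) + 1)))
     + Vreg U t"

definition ocp_solution ::
  "real ^ 'n ^ 'n \<Rightarrow> real ^ 'm ^ 'n \<Rightarrow> real ^ 'n ^ 'n \<Rightarrow> real ^ 'n ^ 'n \<Rightarrow> real ^ 'm ^ 'm \<Rightarrow>
   (real ^ ('h \<times> 'm) \<Rightarrow> nat \<Rightarrow> ereal) \<Rightarrow> nat \<Rightarrow> real ^ 'n \<Rightarrow> real ^ ('h::{finite,linorder} \<times> 'm)" where
  "ocp_solution A B Q Qf R Vreg t x =
     (THE U. is_arg_min (ocp_cost A B Q Qf R Vreg t x) (\<lambda>_. True) U)"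

definition first_block :: "real ^ ('h::{finite,linorder} \<times> 'm) ^ 'm" where
  "first_block = (\<chi> i j. if stage (fst j) = 1 \<and> snd j = i then 1 else 0)"

definition mpc_closed_loop ::
  "real ^ 'n ^ 'n \<Rightarrow> real ^ 'm ^ 'n \<Rightarrow> real ^ 'n ^ 'n \<Rightarrow> real ^ 'n ^ 'n \<Rightarrow> real ^ 'm ^ 'm \<Rightarrow>
   (real ^ ('h::{finite,linorder} \<times> 'm) \<Rightarrow> nat \<Rightarrow> ereal) \<Rightarrow> nat \<Rightarrow> real ^ 'n \<Rightarrow> real ^ 'n" where
  "mpc_closed_loop A B Q Qf R Vreg t x =
     A *v x + B *v (first_block *v ocp_solution A B Q Qf R Vreg t x)"


section \<open>Condensed problem data\<close>

definition A_bar :: "real ^ 'n ^ 'n \<Rightarrow> real ^ 'n ^ ('h::{finite,linorder} \<times> 'n)" where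
  "A_bar A = (\<chi> i j. mat_power A (stage (fst i)) $ snd i $ j)"

definition B_bar ::
  "real ^ 'n ^ 'n \<Rightarrow> real ^ 'm ^ 'n \<Rightarrow> real ^ ('h \<times> 'm) ^ ('h::{finite,linorder} \<times> 'n)" where
  "B_bar A B = (\<chi> i j.
     if fst j \<le> fst i
     then (mat_power A (stage (fst i) - stage (fst j)) ** B) $ snd i $ snd j
     else 0)"

definition Q_bar ::
  "real ^ 'n ^ 'n \<Rightarrow> real ^ 'n ^ 'n \<Rightarrow> real ^ ('h \<times> 'n) ^ ('h::{finite,linorder} \<times> 'n)" where
  "Q_bar Q Qf = (\<chi> i j.
     if fst i = fst j
     then (if stage (fst i) = CARD('h) then Qf else Q) $ snd i $ snd j
     else 0)"

definition R_bar :: "real ^ 'm ^ 'm \<Rightarrow> real ^ ('h \<times> 'm) ^ ('h::{finite,linorder} \<times> 'm)" where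
  "R_bar R = (\<chi> i j. if fst i = fst j then R $ snd i $ snd j else 0)"

definition C_mat ::
  "real ^ 'n ^ 'n \<Rightarrow> real ^ 'm ^ 'n \<Rightarrow> real ^ 'n ^ 'n \<Rightarrow> real ^ 'n ^ 'n \<Rightarrow>
   real ^ 'n ^ ('h::{finite,linorder} \<times> 'm)" where
  "C_mat A B Q Qf = transpose (B_bar A B) ** Q_bar Q Qf ** A_bar A"

definition D_mat ::
  "real ^ 'n ^ 'n \<Rightarrow> real ^ 'm ^ 'n \<Rightarrow> real ^ 'n ^ 'n \<Rightarrow> real ^ 'n ^ 'n \<Rightarrow> real ^ 'm ^ 'm \<Rightarrow>
   real ^ ('h \<times> 'm) ^ ('h::{finite,linorder} \<times> 'm)" where
  "D_mat A B Q Qf R = R_bar R + transpose (B_bar A B) ** Q_bar Q Qf ** B_bar A B"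


section \<open>Convex, closed and proper extended-real functions\<close>

definition ereal_epigraph :: "('a \<Rightarrow> ereal) \<Rightarrow> ('a \<times> real) set" where
  "ereal_epigraph f = {(v, r). f v \<le> ereal r}"

definition convex_closed_proper :: "('a::euclidean_space \<Rightarrow> ereal) \<Rightarrow> bool" where
  "convex_closed_proper f \<longleftrightarrow>
     convex (ereal_epigraph f) \<and> closed (ereal_epigraph f) \<and>
     (\<forall>v. f v \<noteq> -\<infinity>) \<and> (\<exists>v. f v \<noteq> \<infinity>)"


section \<open>Strong contraction\<close>

definition is_trajectory :: "(nat \<Rightarrow> 'a \<Rightarrow> 'a) \<Rightarrow> (nat \<Rightarrow> 'a) \<Rightarrow> bool" where
  "is_trajectory f \<xi> \<longleftrightarrow> (\<forall>t. \<xi> (t + 1) = f t (\<xi> t))"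

definition strongly_contracting ::
  "real ^ 'n ^ 'n \<Rightarrow> real \<Rightarrow> (nat \<Rightarrow> real ^ 'n \<Rightarrow> real ^ 'n) \<Rightarrow> bool" where
  "strongly_contracting P \<eta> f \<longleftrightarrow>
     pos_def_mat P \<and> 0 < \<eta> \<and> \<eta> < 1 \<and>
     (\<forall>\<xi> \<zeta>. is_trajectory f \<xi> \<longrightarrow> is_trajectory f \<zeta> \<longrightarrow>
       (\<forall>t. weighted_norm P (\<xi> (t + 1) - \<zeta> (t + 1)) \<le> \<eta> * weighted_norm P (\<xi> t - \<zeta> t)))"

end

theory Submission
  imports Defs
begin

text \<open>In condensed form the optimal control problem minimises
  \<open>(C x) \<bullet> U + U \<bullet> (D U) / 2 + (\<Sum>h. \<ell>\<^sub>h (u\<^sub>h))\<close>, so the optimality condition says that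
  \<open>- (C x + D U)\<close> is a subgradient of the regularizer at the optimal \<open>U\<close>.  The regularizer is a
  sum over the stages, hence this condition holds stage by stage: the block
  \<open>- (C x + D U)\<^sub>h\<close> is a subgradient of \<open>\<ell>\<^sub>h\<close> at \<open>u\<^sub>h\<close>.  Subdifferentials of convex functions are
  monotone, so the difference \<open>(\<Delta>x, \<Delta>U)\<close> of two optimal pairs satisfies
  \<open>\<Delta>u\<^sub>h \<bullet> (C \<Delta>x + D \<Delta>U)\<^sub>h \<le> 0\<close> at every stage (\<open>stage_gradient_monotone\<close>).

  The quadratic form of the matrix inequality, evaluated at \<open>(\<Delta>x, \<Delta>U)\<close>, is the contraction
  defect of one closed-loop step minus twice the sum of these inner products with weights
  \<open>\<lambda>\<^sub>h\<close> (\<open>LMI_quad_form\<close>).  Being nonpositive, it bounds the defect by a nonpositive number: the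
  matrix inequality is the S-procedure certificate that the stagewise monotonicity constraints
  force contraction, and separate multipliers are possible because monotonicity holds at each
  stage separately.

  The solution map is a definite description, so this argument needs the minimiser to exist
  and to be unique.  Existence and the optimality condition are obtained
  without extended-real arithmetic by moving the regularizer into the constraints: a real
  variable \<open>r\<^sub>h\<close> with \<open>\<ell>\<^sub>h (u\<^sub>h) \<le> r\<^sub>h\<close> replaces the value of \<open>\<ell>\<^sub>h\<close>.  The problem becomes the
  minimisation of a quadratic function, linear in \<open>r\<close>, over a closed convex set, and affine
  minorants of the \<open>\<ell>\<^sub>h\<close> together with positive definiteness of \<open>D\<close> make its sublevel sets compact
  (\<open>epi_minimizer_exists\<close>).  Uniqueness is the monotonicity inequality summed over the stages
  for two minimisers at the same state.\<close>


section \<open>Quadratic forms and stacked vectors\<close>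

text \<open>Transposes are to be moved to the other side of an inner product; the library's rewriting
  of \<open>transpose M *v x\<close> to \<open>x v* M\<close> would hide them.\<close>

declare transpose_matrix_vector [simp del]

lemma inner_transpose_mult:
  fixes M :: "real ^ 'c ^ 'r"
  shows "x \<bullet> (transpose M *v y) = (M *v x) \<bullet> y"
  by (metis dot_lmul_matrix inner_commute transpose_matrix_vector)

lemma inner_symmetric_mult:
  assumes "symmetric_mat M"
  shows "x \<bullet> (M *v y) = y \<bullet> (M *v x)"
  by (metis assms inner_commute inner_transpose_mult symmetric_mat_def)

lemma uminus_matrix_vector_mult: "(- M) *v x = - (M *v (x :: real ^ 'n))"
  by (simp add: vec_eq_iff matrix_vector_mult_def sum_negf)

lemma quad_form_add:
  assumes "symmetric_mat M"
  shows "quad_form M (x + y) = quad_form M x + 2 * (x \<bullet> (M *v y)) + quad_form M y"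
  unfolding quad_form_def
  using inner_symmetric_mult[OF assms, of y x]
  by (simp add: matrix_vector_right_distrib inner_add_left inner_add_right)

lemma quad_form_scaleR: "quad_form M (c *\<^sub>R x) = c\<^sup>2 * quad_form M x"
  by (simp add: quad_form_def power2_eq_square matrix_vector_mult_scaleR)

lemma quad_form_0 [simp]: "quad_form M 0 = 0"
  by (simp add: quad_form_def)

lemma continuous_on_quad_form [continuous_intros]:
  "continuous_on S f \<Longrightarrow> continuous_on S (\<lambda>x. quad_form M (f x))"
  unfolding quad_form_def
  by (intro continuous_on_inner bounded_linear.continuous_on[OF matrix_vector_mul_bounded_linear])

text \<open>By homogeneity it suffices to take for \<open>\<mu>\<close> the minimum of the form on the compact unit
  sphere.\<close>

lemma pos_def_coercive:
  assumes "pos_def_mat (M :: real ^ 'n ^ 'n)"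
  obtains \<mu> where "0 < \<mu>" "\<And>v. \<mu> * (norm v)\<^sup>2 \<le> quad_form M v"
proof -
  have "sphere (0::real^'n) 1 \<noteq> {}"
    by simp
  moreover have "continuous_on (sphere 0 1) (quad_form M)"
    using continuous_on_quad_form[OF continuous_on_id] by simp
  ultimately obtain w where w: "norm w = 1" "\<And>v. norm v = 1 \<Longrightarrow> quad_form M w \<le> quad_form M v"
    using continuous_attains_inf[of "sphere (0::real^'n) 1" "quad_form M"] by auto
  have "quad_form M w * (norm v)\<^sup>2 \<le> quad_form M v" for v
  proof (cases "v = 0")
    case False
    have "quad_form M v = (norm v)\<^sup>2 * quad_form M (v /\<^sub>R norm v)"
      using False quad_form_scaleR[of M "norm v" "v /\<^sub>R norm v"] by simp
    moreover have "quad_form M w \<le> quad_form M (v /\<^sub>R norm v)"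
      using False by (intro w) simp
    ultimately show ?thesis
      by (metis mult.commute mult_left_mono zero_le_power2)
  qed simp
  moreover have "0 < quad_form M w"
    using assms w(1) unfolding pos_def_mat_def by (metis norm_zero zero_neq_one)
  ultimately show thesis
    using that by blast
qed

lemma inner_eq_sum_block:
  fixes U W :: "real ^ ('h::finite \<times> 'm::finite)"
  shows "U \<bullet> W = (\<Sum>h\<in>UNIV. block U h \<bullet> block W h)"
  by (simp add: inner_vec_def block_def sum.cartesian_product UNIV_Times_UNIV case_prod_beta)

lemma block_simps [simp]:
  "block (U + W) h = block U h + block W h"
  "block (U - W) h = block U h - block W h"
  "block (c *\<^sub>R U) h = c *\<^sub>R block U h"
  "block (- U) h = - block U h"
  by (simp_all add: block_def vec_eq_iff)

definition stack :: "('h::finite \<Rightarrow> real ^ 'm) \<Rightarrow> real ^ ('h \<times> 'm::finite)" where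
  "stack u = (\<chi> i. u (fst i) $ snd i)"

lemma block_stack [simp]: "block (stack u) h = u h"
  by (simp add: block_def stack_def vec_eq_iff)

definition join :: "real ^ 'a \<Rightarrow> real ^ 'b \<Rightarrow> real ^ ('a::finite + 'b::finite)" where
  "join x y = (\<chi> i. case i of Inl a \<Rightarrow> x $ a | Inr b \<Rightarrow> y $ b)"

lemma sum_UNIV_Plus:
  fixes f :: "'a::finite + 'b::finite \<Rightarrow> real"
  shows "sum f UNIV = (\<Sum>a\<in>UNIV. f (Inl a)) + (\<Sum>b\<in>UNIV. f (Inr b))"
  by (simp add: UNIV_Plus_UNIV[symmetric] sum.Plus del: UNIV_Plus_UNIV)

lemma inner_join: "join x y \<bullet> join x' y' = x \<bullet> x' + y \<bullet> y'"
  by (simp add: inner_vec_def sum_UNIV_Plus join_def)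

lemma block_mat_mult_join:
  "block_mat M11 M12 M21 M22 *v join x y = join (M11 *v x + M12 *v y) (M21 *v x + M22 *v y)"
  by (simp add: vec_eq_iff block_mat_def join_def matrix_vector_mult_def sum_UNIV_Plus
           split: sum.split)

text \<open>A Kronecker product with the identity on the right weights whole blocks; this is where
  one multiplier per stage comes from.\<close>

lemma inner_kronecker_diag_mult:
  fixes U W :: "real ^ ('h::finite \<times> 'm::finite)"
  shows "U \<bullet> (kronecker (diag_mat lam) (mat 1) *v W)
       = (\<Sum>h\<in>UNIV. lam $ h * (block U h \<bullet> block W h))"
proof -
  have "kronecker (diag_mat lam) (mat 1) *v W = stack (\<lambda>h. lam $ h *\<^sub>R block W h)"
  proof -
    have "(\<Sum>j\<in>UNIV. diag_mat lam $ fst i $ fst j * (mat 1 :: real^'m^'m) $ snd i $ snd j * W $ j)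
          = lam $ fst i * W $ i" for i
    proof -
      have "(\<Sum>j\<in>UNIV. diag_mat lam $ fst i $ fst j * (mat 1 :: real^'m^'m) $ snd i $ snd j * W $ j)
          = (\<Sum>j\<in>UNIV. if i = j then lam $ fst i * W $ i else 0)"
        by (intro sum.cong) (auto simp: diag_mat_def mat_def prod_eq_iff)
      then show ?thesis by simp
    qed
    then show ?thesis
      by (simp add: vec_eq_iff matrix_vector_mult_def kronecker_def stack_def block_def)
  qed
  then show ?thesis
    by (simp add: inner_eq_sum_block)
qed


section \<open>The condensed form of the cost\<close>

lemma inv_stage_stage [simp]: "inv stage (stage h) = (h :: 'h::{finite,linorder})"
  using bij_betw_stage[where 'h='h] by (simp add: bij_betw_def)

lemma stage_bounds: "1 \<le> stage (h :: 'h::{finite,linorder})" "stage h \<le> CARD('h)"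
  using bij_betw_stage[where 'h='h] by (auto simp: bij_betw_def)

lemma stage_inv_stage:
  "1 \<le> k \<Longrightarrow> k \<le> CARD('h) \<Longrightarrow> stage (inv stage k :: 'h::{finite,linorder}) = k"
  using bij_betw_stage[where 'h='h] by (intro f_inv_into_f) (auto simp: bij_betw_def)

lemma stage_le_iff: "stage (h :: 'h::{finite,linorder}) \<le> stage k \<longleftrightarrow> h \<le> k"
proof
  show "h \<le> k \<Longrightarrow> stage h \<le> stage k"
    unfolding stage_def by (intro card_mono) auto
  show "h \<le> k" if "stage h \<le> stage k"
  proof (rule ccontr)
    assume "\<not> h \<le> k"
    then have "stage k < stage h"
      unfolding stage_def by (intro psubset_card_mono) auto
    with that show False by simp
  qed
qed

lemma sum_stage:
  fixes f :: "nat \<Rightarrow> 'a::comm_monoid_add"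
  shows "(\<Sum>h\<in>(UNIV :: 'h::{finite,linorder} set). f (stage h)) = sum f {1..CARD('h)}"
  by (rule sum.reindex_bij_betw[OF bij_betw_stage])

lemma plant_state_eq:
  "plant_state A B x u k
   = mat_power A k *v x + (\<Sum>i<k. (mat_power A (k - Suc i) ** B) *v u i)"
proof (induction k)
  case (Suc k)
  have "A *v (\<Sum>i<k. (mat_power A (k - Suc i) ** B) *v u i)
      = (\<Sum>i<k. (mat_power A (Suc k - Suc i) ** B) *v u i)"
    unfolding linear_sum[OF matrix_vector_mul_linear]
  proof (intro sum.cong refl)
    fix i assume "i \<in> {..<k}"
    then have "Suc k - Suc i = Suc (k - Suc i)" by auto
    then show "A *v ((mat_power A (k - Suc i) ** B) *v u i)
             = (mat_power A (Suc k - Suc i) ** B) *v u i"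
      by (simp add: matrix_vector_mul_assoc matrix_mul_assoc)
  qed
  with Suc show ?case
    by (simp add: matrix_vector_right_distrib matrix_vector_mul_assoc matrix_mul_lid)
qed simp

text \<open>The definition of \<open>A_bar\<close> and \<open>B_bar\<close> is the variation of constants formula, with the
  block at stage \<open>h\<close> holding the state \<^emph>\<open>after\<close> input \<open>u\<^sub>h\<close>, hence the shift by one.  The plant
  recursion counts its inputs from 0, the stages from 1.\<close>

lemma predicted_state_eq_block:
  fixes U :: "real ^ ('h::{finite,linorder} \<times> 'm::finite)"
  shows "predicted_state A B x U (stage h + 1) = block (A_bar A *v x + B_bar A B *v U) h"
proof -
  have 1: "block (A_bar A *v x) h = mat_power A (stage h) *v x"
    by (simp add: block_def A_bar_def matrix_vector_mult_def vec_eq_iff)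
  have "block (B_bar A B *v U) h
      = (\<Sum>j\<in>UNIV. if j \<le> h then (mat_power A (stage h - stage j) ** B) *v block U j else 0)"
  proof (rule vec_eq_iff[THEN iffD2], rule allI)
    fix i
    have "block (B_bar A B *v U) h $ i
        = (\<Sum>(j, l)\<in>UNIV. (if j \<le> h then (mat_power A (stage h - stage j) ** B) $ i $ l else 0)
             * U $ (j, l))"
      by (simp add: block_def B_bar_def matrix_vector_mult_def case_prod_beta cong: if_cong)
    also have "\<dots> = (\<Sum>j\<in>UNIV. \<Sum>l\<in>UNIV.
             (if j \<le> h then (mat_power A (stage h - stage j) ** B) $ i $ l else 0) * U $ (j, l))"
      by (simp add: sum.cartesian_product)
    also have "\<dots> = (\<Sum>j\<in>UNIV. if j \<le> h then (mat_power A (stage h - stage j) ** B) *v block U j else 0) $ i"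
      unfolding sum_component
      by (intro sum.cong refl) (simp add: matrix_vector_mult_def block_def)
    finally show "block (B_bar A B *v U) h $ i = \<dots>" .
  qed
  also have "\<dots> = (\<Sum>j\<in>{..h}. (mat_power A (stage h - stage j) ** B) *v block U j)"
    by (simp add: sum.If_cases atMost_def)
  also have "\<dots> = (\<Sum>i<stage h. (mat_power A (stage h - Suc i) ** B) *v block U (inv stage (i + 1)))"
  proof (rule sum.reindex_bij_witness[where i = "\<lambda>i. inv stage (i + 1)" and j = "\<lambda>j. stage j - 1"])
    fix j assume "j \<in> {..h}"
    then have j: "stage j \<le> stage h" "1 \<le> stage j"
      using stage_bounds(1)[of j] by (simp_all add: stage_le_iff)
    show "inv stage (stage j - 1 + 1) = j" "stage j - 1 \<in> {..<stage h}"
      using j by auto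
    show "(mat_power A (stage h - Suc (stage j - 1)) ** B) *v block U (inv stage (stage j - 1 + 1))
        = (mat_power A (stage h - stage j) ** B) *v block U j"
      using j by simp
  next
    fix i assume i: "i \<in> {..<stage h}"
    have "stage (inv stage (i + 1) :: 'h) = i + 1"
      using i stage_bounds(2)[of h] by (intro stage_inv_stage) auto
    then show "stage (inv stage (i + 1) :: 'h) - 1 = i" "(inv stage (i + 1) :: 'h) \<in> {..h}"
      using i by (simp_all add: stage_le_iff[symmetric])
  qed
  finally show ?thesis
    by (simp add: predicted_state_def plant_state_eq 1)
qed

lemma block_Q_bar_mult:
  fixes X :: "real ^ ('h::{finite,linorder} \<times> 'n::finite)"
  shows "block (Q_bar Q Qf *v X) h = (if stage h = CARD('h) then Qf else Q) *v block X h"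
proof (rule vec_eq_iff[THEN iffD2], rule allI)
  fix i
  let ?M = "if stage h = CARD('h) then Qf else Q"
  have "block (Q_bar Q Qf *v X) h $ i
      = (\<Sum>j\<in>UNIV. \<Sum>l\<in>UNIV. (if h = j then ?M $ i $ l else 0) * X $ (j, l))"
    by (simp add: block_def Q_bar_def matrix_vector_mult_def sum.cartesian_product case_prod_beta
        cong: if_cong)
  also have "\<dots> = (\<Sum>j\<in>UNIV. if h = j then \<Sum>l\<in>UNIV. ?M $ i $ l * X $ (j, l) else 0)"
    by (intro sum.cong) auto
  finally show "block (Q_bar Q Qf *v X) h $ i = (?M *v block X h) $ i"
    by (simp add: block_def matrix_vector_mult_def)
qed

lemma R_bar_eq_Q_bar: "R_bar R = Q_bar R R"
  by (simp add: R_bar_def Q_bar_def vec_eq_iff)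

lemma quad_form_Q_bar:
  fixes X :: "real ^ ('h::{finite,linorder} \<times> 'n::finite)"
  shows "quad_form (Q_bar Q Qf) X
    = (\<Sum>h\<in>UNIV. quad_form (if stage h = CARD('h) then Qf else Q) (block X h))"
  by (simp add: quad_form_def inner_eq_sum_block block_Q_bar_mult)

lemma symmetric_Q_bar:
  assumes "symmetric_mat Q" "symmetric_mat Qf"
  shows "symmetric_mat (Q_bar Q Qf :: real ^ ('h \<times> 'n::finite) ^ ('h::{finite,linorder} \<times> 'n::finite))"
proof -
  have "M $ i $ j = M $ j $ i" if "symmetric_mat M" for M :: "real ^ 'n ^ 'n" and i j
  proof -
    have "M $ i $ j = transpose M $ j $ i"
      by (simp add: transpose_def)
    with that show ?thesis by (simp add: symmetric_mat_def)
  qed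
  from this[OF assms(1)] this[OF assms(2)] show ?thesis
    unfolding symmetric_mat_def transpose_def Q_bar_def vec_eq_iff by simp
qed

text \<open>The stage cost weights the states \<open>x\<^sub>1, \<dots>, x\<^sub>H\<close>, whereas the stacked prediction consists of
  \<open>x\<^sub>2, \<dots>, x\<^sub>H\<^sub>+\<^sub>1\<close>.  Splitting off \<open>x\<^sub>1 = x\<close> shifts the sum by one stage and leaves the terminal
  state in the last block.\<close>

lemma sum_state_cost:
  fixes U :: "real ^ ('h::{finite,linorder} \<times> 'm::finite)"
  shows "(\<Sum>h\<in>(UNIV::'h set). quad_form Q (predicted_state A B x U (stage h)))
           + quad_form Qf (predicted_state A B x U (CARD('h) + 1))
       = quad_form Q x + quad_form (Q_bar Q Qf) (A_bar A *v x + B_bar A B *v U)"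
proof -
  define z where "z = predicted_state A B x U"
  obtain N where N: "CARD('h) = Suc N"
    using zero_less_card_finite[where 'a='h] gr0_conv_Suc by blast
  have "(\<Sum>h\<in>(UNIV::'h set). quad_form Q (z (stage h))) + quad_form Qf (z (CARD('h) + 1))
      = (\<Sum>k=1..Suc N. quad_form Q (z k)) + quad_form Qf (z (Suc N + 1))"
    using sum_stage[where 'h='h and f = "\<lambda>k. quad_form Q (z k)"] N by simp
  also have "(\<Sum>k=1..Suc N. quad_form Q (z k)) = quad_form Q (z 1) + (\<Sum>k=1..N. quad_form Q (z (k + 1)))"
    by (simp add: sum.atLeast_Suc_atMost sum.shift_bounds_cl_Suc_ivl del: sum.cl_ivl_Suc)
  also have "(\<Sum>k=1..N. quad_form Q (z (k + 1)))
      = (\<Sum>k=1..N. quad_form (if k = Suc N then Qf else Q) (z (k + 1)))"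
    by (intro sum.cong) auto
  also have "quad_form Q (z 1) + \<dots> + quad_form Qf (z (Suc N + 1))
      = quad_form Q (z 1) + (\<Sum>k=1..Suc N. quad_form (if k = Suc N then Qf else Q) (z (k + 1)))"
    by simp
  also have "(\<Sum>k=1..Suc N. quad_form (if k = Suc N then Qf else Q) (z (k + 1)))
      = (\<Sum>h\<in>(UNIV::'h set). quad_form (if stage h = CARD('h) then Qf else Q) (z (stage h + 1)))"
    using sum_stage[where 'h='h and f = "\<lambda>k. quad_form (if k = Suc N then Qf else Q) (z (k + 1))"] N
    by simp
  also have "\<dots> = quad_form (Q_bar Q Qf) (A_bar A *v x + B_bar A B *v U)"
    by (simp only: quad_form_Q_bar z_def predicted_state_eq_block)
  finally show ?thesis
    by (simp add: z_def predicted_state_def)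
qed

text \<open>The state enters the dependence on \<open>U\<close> only through the linear term \<open>C x\<close>; all else that
  depends on \<open>x\<close> is an additive constant.\<close>

lemma ocp_cost_condensed:
  fixes U :: "real ^ ('h::{finite,linorder} \<times> 'm::finite)"
    and Q Qf :: "real ^ 'n ^ 'n"
  assumes "symmetric_mat Q" "symmetric_mat Qf"
  shows "ocp_cost A B Q Qf R Vreg t x U
    = ereal ((quad_form Q x + quad_form (Q_bar Q Qf :: real ^ ('h \<times> 'n) ^ ('h \<times> 'n)) (A_bar A *v x)) / 2
        + (C_mat A B Q Qf *v x) \<bullet> U + quad_form (D_mat A B Q Qf R) U / 2)
      + Vreg U t"
proof -
  let ?Qb = "Q_bar Q Qf :: real ^ ('h \<times> 'n) ^ ('h \<times> 'n)"
  have "quad_form ?Qb (A_bar A *v x + B_bar A B *v U)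
      = quad_form ?Qb (A_bar A *v x) + 2 * ((C_mat A B Q Qf *v x) \<bullet> U)
        + quad_form ?Qb (B_bar A B *v U)"
    using inner_symmetric_mult[OF symmetric_Q_bar[OF assms], of "A_bar A *v x" "B_bar A B *v U"]
    by (simp add: quad_form_add[OF symmetric_Q_bar[OF assms]] C_mat_def
        matrix_vector_mul_assoc[symmetric] inner_transpose_mult inner_commute[of _ U])
  moreover have "quad_form (D_mat A B Q Qf R) U
      = (\<Sum>h\<in>UNIV. quad_form R (block U h)) + quad_form ?Qb (B_bar A B *v U)"
  proof -
    have "quad_form (R_bar R) U = (\<Sum>h\<in>UNIV. quad_form R (block U h))"
      by (simp add: R_bar_eq_Q_bar quad_form_Q_bar)
    then show ?thesis
      by (simp add: quad_form_def D_mat_def matrix_vector_mult_add_rdistrib inner_add_right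
          matrix_vector_mul_assoc[symmetric] inner_transpose_mult)
  qed
  ultimately show ?thesis
    using sum_state_cost[where Q=Q and Qf=Qf and A=A and B=B and x=x and U=U]
    unfolding ocp_cost_def sum.distrib
    by (intro arg_cong[where f = "\<lambda>a. ereal a + Vreg U t"]) (simp add: field_simps)
qed

section \<open>Quadratic programs with a stagewise convex regularizer\<close>

text \<open>The product of the epigraphs of the stage regularizers, with the inputs and the bounds
  collected in one vector each.\<close>

definition stage_epigraph ::
  "('h::finite \<Rightarrow> real ^ 'm \<Rightarrow> ereal) \<Rightarrow> ((real ^ ('h \<times> 'm::finite)) \<times> (real ^ 'h)) set" where
  "stage_epigraph l = {(U, r). \<forall>h. l h (block U h) \<le> ereal (r $ h)}"

definition epi_cost ::
  "real ^ ('h::finite \<times> 'm::finite) ^ ('h \<times> 'm) \<Rightarrow> real ^ ('h \<times> 'm)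
     \<Rightarrow> (real ^ ('h \<times> 'm)) \<times> (real ^ 'h) \<Rightarrow> real" where
  "epi_cost D c z = c \<bullet> fst z + quad_form D (fst z) / 2 + (\<Sum>h\<in>UNIV. snd z $ h)"

text \<open>Minimisation over pairs \<open>(U, r)\<close> with \<open>l h (block U h) \<le> r\<^sub>h\<close> is equivalent to minimisation
  of the extended-real cost over \<open>U\<close>: for a given \<open>U\<close> with finite cost the best \<open>r\<close> consists of
  the values of the regularizers.\<close>

definition epi_minimizer ::
  "real ^ ('h::finite \<times> 'm::finite) ^ ('h \<times> 'm) \<Rightarrow> real ^ ('h \<times> 'm)
     \<Rightarrow> ('h \<Rightarrow> real ^ 'm \<Rightarrow> ereal) \<Rightarrow> (real ^ ('h \<times> 'm)) \<times> (real ^ 'h) \<Rightarrow> bool" where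
  "epi_minimizer D c l z \<longleftrightarrow>
     z \<in> stage_epigraph l \<and> (\<forall>z'\<in>stage_epigraph l. epi_cost D c z \<le> epi_cost D c z')"

text \<open>A point strictly below the graph is separated strictly from the epigraph.  The separating
  hyperplane is not vertical, because the point lies under a point of the effective domain, so
  it is the graph of an affine function.\<close>

lemma affine_minorant:
  fixes f :: "'a::euclidean_space \<Rightarrow> ereal"
  assumes "convex_closed_proper f"
  obtains g c where "\<And>v r. f v \<le> ereal r \<Longrightarrow> g \<bullet> v + c \<le> r"
proof -
  obtain v0 where v0: "f v0 \<noteq> \<infinity>"
    using assms by (auto simp: convex_closed_proper_def)
  then obtain r0 where r0: "f v0 = ereal r0"
    using assms by (cases "f v0") (auto simp: convex_closed_proper_def)
  have "(v0, r0 - 1) \<notin> ereal_epigraph f"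
    by (simp add: ereal_epigraph_def r0)
  then have "\<exists>a b. a \<bullet> (v0, r0 - 1) < b \<and> (\<forall>z\<in>ereal_epigraph f. b < a \<bullet> z)"
    using assms by (intro separating_hyperplane_closed_point) (auto simp: convex_closed_proper_def)
  then obtain a b where a: "a \<bullet> (v0, r0 - 1) < b" "\<And>z. z \<in> ereal_epigraph f \<Longrightarrow> b < a \<bullet> z"
    by blast
  obtain g s where gs: "a = (g, s)" by (cases a)
  \<comment> \<open>The two points over \<open>v0\<close> lie on different sides of the hyperplane, so its vertical coefficient
    \<open>s\<close> is positive.\<close>
  have "b < g \<bullet> v0 + s * r0"
    using a(2)[of "(v0, r0)"] by (simp add: ereal_epigraph_def r0 gs inner_prod_def)
  then have s: "0 < s"
    using a(1) by (simp add: gs inner_prod_def algebra_simps)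
  show thesis
  proof
    fix v r assume "f v \<le> ereal r"
    then have "b < g \<bullet> v + s * r"
      using a(2)[of "(v, r)"] by (simp add: ereal_epigraph_def gs inner_prod_def)
    then show "(- g /\<^sub>R s) \<bullet> v + b / s \<le> r"
      using s by (simp add: field_simps)
  qed
qed

lemma stage_epigraph_eq_INT:
  "stage_epigraph l = (\<Inter>h. (\<lambda>z. (block (fst z) h, snd z $ h)) -` ereal_epigraph (l h))"
  by (auto simp: stage_epigraph_def ereal_epigraph_def)

lemma linear_stage_component: "linear (\<lambda>z. (block (fst z) h, snd z $ h))"
  by (rule linearI) auto

lemma closed_stage_epigraph:
  assumes "\<And>h. convex_closed_proper (l h)"
  shows "closed (stage_epigraph l)"
  unfolding stage_epigraph_eq_INT using assms
  by (intro closed_INT ballI closed_vimage linear_continuous_on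
      linear_stage_component[THEN linear_conv_bounded_linear[THEN iffD1]])
    (auto simp: convex_closed_proper_def)

lemma convex_stage_epigraph:
  assumes "\<And>h. convex_closed_proper (l h)"
  shows "convex (stage_epigraph l)"
  unfolding stage_epigraph_eq_INT using assms
  by (intro convex_INT convex_linear_vimage linear_stage_component)
    (auto simp: convex_closed_proper_def)

lemma stage_epigraph_nonempty:
  assumes "\<And>h. convex_closed_proper (l h)"
  shows "stage_epigraph l \<noteq> {}"
proof -
  have "\<exists>v r. l h v \<le> ereal r" for h
  proof -
    obtain v where "l h v \<noteq> \<infinity>"
      using assms[of h] by (auto simp: convex_closed_proper_def)
    then have "l h v \<le> ereal (real_of_ereal (l h v))"
      by (cases "l h v") auto
    then show ?thesis by blast
  qed
  then obtain u r where "\<And>h. l h (u h) \<le> ereal (r h)"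
    by metis
  then have "(stack u, \<chi> h. r h) \<in> stage_epigraph l"
    by (simp add: stage_epigraph_def)
  then show ?thesis by blast
qed

lemma continuous_on_epi_cost: "continuous_on S (epi_cost D c)"
  unfolding epi_cost_def by (intro continuous_intros) auto

lemma quadratic_sublevel_bounded:
  assumes "0 < (\<mu>::real)" "0 \<le> L" "\<mu> * x\<^sup>2 - L * x \<le> M"
  shows "x \<le> max 1 ((L + \<bar>M\<bar>) / \<mu>)"
proof (rule ccontr)
  assume "\<not> ?thesis"
  then have "1 < x" "(L + \<bar>M\<bar>) / \<mu> < x"
    by auto
  then have x: "1 < x" "L + \<bar>M\<bar> < \<mu> * x"
    using assms(1) by (simp_all add: pos_divide_less_eq mult.commute)
  then have "(L + \<bar>M\<bar>) * x < (\<mu> * x) * x"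
    by (intro mult_strict_right_mono) auto
  moreover have "\<bar>M\<bar> * 1 \<le> \<bar>M\<bar> * x"
    using x(1) by (intro mult_left_mono) auto
  ultimately show False
    using assms(3) by (simp add: algebra_simps power2_eq_square)
qed

text \<open>The affine minorants bound \<open>\<Sum>r\<close> below by an affine function of \<open>U\<close>, which the quadratic
  term dominates; this bounds \<open>U\<close>.  Then each \<open>r\<^sub>h\<close> is bounded below by its own minorant, and
  since the cost bounds their sum above, each one is bounded above too.\<close>

lemma bounded_sublevel_epi_cost:
  fixes D :: "real ^ ('h::finite \<times> 'm::finite) ^ ('h \<times> 'm)"
  assumes D: "pos_def_mat D" and l: "\<And>h. convex_closed_proper (l h)"
  shows "bounded {z \<in> stage_epigraph l. epi_cost D c z \<le> M}"
proof -
  have "\<forall>h. \<exists>g k. \<forall>v r. l h v \<le> ereal r \<longrightarrow> g \<bullet> v + k \<le> r"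
    by (metis affine_minorant[OF l])
  then obtain g k where gk: "\<And>h v r. l h v \<le> ereal r \<Longrightarrow> g h \<bullet> v + k h \<le> r"
    by metis
  obtain \<mu> where \<mu>: "0 < \<mu>" "\<And>v. \<mu> * (norm v)\<^sup>2 \<le> quad_form D v"
    using pos_def_coercive[OF D] by blast
  define G where "G = stack g"
  define K where "K = (\<Sum>h\<in>UNIV. \<bar>k h\<bar>)"
  define N where "N = max 1 ((norm (c + G) + \<bar>M + K\<bar>) / (\<mu> / 2))"
  define r_min where "r_min = - (norm G * N + K)"
  define r_sum where "r_sum = norm c * N + M"
  have lower: "- (norm G * norm U) - K \<le> r $ h" "G \<bullet> U - K \<le> sum (($) r) UNIV"
    if "(U, r) \<in> stage_epigraph l" for U r h
  proof -
    have *: "g h \<bullet> block U h + k h \<le> r $ h" for h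
      using that by (intro gk) (auto simp: stage_epigraph_def)
    have "(\<Sum>h\<in>UNIV. g h \<bullet> block U h + k h) \<le> sum (($) r) UNIV"
      by (intro sum_mono *)
    moreover have "- K \<le> sum k UNIV"
      unfolding K_def sum_negf[symmetric] by (intro sum_mono) auto
    ultimately show "G \<bullet> U - K \<le> sum (($) r) UNIV"
      by (simp add: inner_eq_sum_block G_def sum.distrib)
    have nb: "norm (block V h) \<le> norm V" for V :: "real ^ ('h \<times> 'm)"
    proof -
      have "block V h \<bullet> block V h \<le> V \<bullet> V"
        unfolding inner_eq_sum_block[of V] by (rule member_le_sum) auto
      then show ?thesis by (simp add: norm_le)
    qed
    have "\<bar>g h \<bullet> block U h\<bar> \<le> norm (block G h) * norm (block U h)"
      using Cauchy_Schwarz_ineq2[of "g h" "block U h"] by (simp add: G_def)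
    also have "\<dots> \<le> norm G * norm U"
      by (intro mult_mono nb) auto
    finally have "- (norm G * norm U) \<le> g h \<bullet> block U h"
      by linarith
    moreover have "\<bar>k h\<bar> \<le> K"
      unfolding K_def by (rule member_le_sum) auto
    ultimately show "- (norm G * norm U) - K \<le> r $ h"
      using *[of h] by linarith
  qed
  have "norm z \<le> N + real CARD('h) * (\<bar>r_sum\<bar> + real CARD('h) * \<bar>r_min\<bar> + \<bar>r_min\<bar>)"
    if z: "z \<in> stage_epigraph l" "epi_cost D c z \<le> M" for z
  proof -
    obtain U r where zUr: "z = (U, r)" by (cases z)
    have cost: "c \<bullet> U + quad_form D U / 2 + sum (($) r) UNIV \<le> M"
      using z(2) by (simp add: epi_cost_def zUr)
    have "- (norm (c + G) * norm U) \<le> (c + G) \<bullet> U"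
      using Cauchy_Schwarz_ineq2[of "c + G" U] by linarith
    then have "\<mu> / 2 * (norm U)\<^sup>2 - norm (c + G) * norm U \<le> M + K"
      using cost lower(2)[of U r] z(1) \<mu>(2)[of U] by (simp add: zUr inner_add_left)
    then have U: "norm U \<le> N"
      unfolding N_def using \<mu>(1) by (intro quadratic_sublevel_bounded) auto
    have r_lower: "- \<bar>r_min\<bar> \<le> r $ h" for h
    proof -
      have "norm G * norm U \<le> norm G * N"
        using U by (intro mult_left_mono) auto
      then show ?thesis
        using lower(1)[of U r h] z(1) by (simp add: zUr r_min_def)
    qed
    have "norm c * norm U \<le> norm c * N"
      using U by (intro mult_left_mono) auto
    moreover have "- (norm c * norm U) \<le> c \<bullet> U"
      using Cauchy_Schwarz_ineq2[of c U] by linarith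
    moreover have "0 \<le> quad_form D U"
      using \<mu>(2)[of U] \<mu>(1) by (smt (verit) mult_nonneg_nonneg zero_le_power2)
    ultimately have sum_r: "sum (($) r) UNIV \<le> r_sum"
      using cost by (simp add: r_sum_def)
    have "\<bar>r $ h\<bar> \<le> \<bar>r_sum\<bar> + real CARD('h) * \<bar>r_min\<bar> + \<bar>r_min\<bar>" for h
    proof -
      have "r $ h + \<bar>r_min\<bar> \<le> (\<Sum>h\<in>UNIV. r $ h + \<bar>r_min\<bar>)"
        using r_lower by (intro member_le_sum) (auto simp: algebra_simps, smt (verit))
      also have "\<dots> \<le> r_sum + real CARD('h) * \<bar>r_min\<bar>"
        using sum_r by (simp add: sum.distrib)
      finally show ?thesis
        using r_lower[of h] by (smt (verit) mult_nonneg_nonneg of_nat_0_le_iff)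
    qed
    then have "norm r \<le> (\<Sum>h\<in>(UNIV::'h set). \<bar>r_sum\<bar> + real CARD('h) * \<bar>r_min\<bar> + \<bar>r_min\<bar>)"
      by (intro order.trans[OF norm_le_l1_cart] sum_mono) 
    moreover have "norm z \<le> norm U + norm r"
      by (simp add: zUr norm_Pair sqrt_sum_squares_le_sum)
    ultimately show ?thesis using U by simp
  qed
  then show ?thesis
    unfolding bounded_iff by blast
qed

lemma epi_minimizer_exists:
  assumes "pos_def_mat D" "\<And>h. convex_closed_proper (l h)"
  obtains z where "epi_minimizer D c l z"
proof -
  obtain z0 where z0: "z0 \<in> stage_epigraph l"
    using stage_epigraph_nonempty[of l] assms(2) by blast
  define S where "S = {z \<in> stage_epigraph l. epi_cost D c z \<le> epi_cost D c z0}"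
  have "S = stage_epigraph l \<inter> {z. epi_cost D c z \<le> epi_cost D c z0}"
    by (auto simp: S_def)
  then have "closed S"
    using closed_stage_epigraph[of l, OF assms(2)]
    by (simp add: closed_Int closed_Collect_le continuous_on_epi_cost)
  moreover have "bounded S"
    unfolding S_def by (rule bounded_sublevel_epi_cost[OF assms])
  ultimately have "compact S"
    by (simp add: compact_eq_bounded_closed)
  moreover have "z0 \<in> S"
    using z0 by (simp add: S_def)
  ultimately obtain z where z: "z \<in> S" "\<And>z'. z' \<in> S \<Longrightarrow> epi_cost D c z \<le> epi_cost D c z'"
    using continuous_attains_inf[of S "epi_cost D c"] continuous_on_epi_cost by blast
  have "epi_cost D c z \<le> epi_cost D c z'" if "z' \<in> stage_epigraph l" for z'
    using z(1) z(2)[of z'] that by (cases "epi_cost D c z' \<le> epi_cost D c z0") (auto simp: S_def)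
  then have "epi_minimizer D c l z"
    using z(1) by (simp add: epi_minimizer_def S_def)
  then show thesis by (rule that)
qed

text \<open>Moving from the minimiser towards \<open>(U', r')\<close> by a fraction \<open>\<tau>\<close> stays in the convex set
  and changes the cost by \<open>\<tau> * (a + \<tau> * b)\<close>, where \<open>a\<close> is the directional derivative.  If \<open>a\<close>
  were negative, a small \<open>\<tau>\<close> would lower the cost.\<close>

lemma epi_minimizer_first_order:
  assumes min: "epi_minimizer D c l (U, r)"
    and D: "symmetric_mat D"
    and l: "\<And>h. convex_closed_proper (l h)"
    and z': "(U', r') \<in> stage_epigraph l"
  shows "0 \<le> (c + D *v U) \<bullet> (U' - U) + (\<Sum>h\<in>UNIV. r' $ h - r $ h)"
proof (rule ccontr)
  define a where "a = (c + D *v U) \<bullet> (U' - U) + (\<Sum>h\<in>UNIV. r' $ h - r $ h)"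
  define b where "b = quad_form D (U' - U) / 2"
  assume "\<not> ?thesis"
  then have a: "a < 0" by (simp add: a_def)
  have S: "(U, r) \<in> stage_epigraph l"
    using min by (simp add: epi_minimizer_def)
  have *: "0 \<le> \<tau> * (a + \<tau> * b)" if "0 < \<tau>" "\<tau> \<le> 1" for \<tau>
  proof -
    have "(1 - \<tau>) *\<^sub>R (U, r) + \<tau> *\<^sub>R (U', r') \<in> stage_epigraph l"
      using convexD_alt[OF convex_stage_epigraph[OF l] S z'] that by simp
    moreover have "(1 - \<tau>) *\<^sub>R (U, r) + \<tau> *\<^sub>R (U', r')
        = (U + \<tau> *\<^sub>R (U' - U), r + \<tau> *\<^sub>R (r' - r))"
      by (simp add: algebra_simps)
    ultimately have "epi_cost D c (U, r) \<le> epi_cost D c (U + \<tau> *\<^sub>R (U' - U), r + \<tau> *\<^sub>R (r' - r))"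
      using min by (simp add: epi_minimizer_def)
    moreover have "epi_cost D c (U + \<tau> *\<^sub>R (U' - U), r + \<tau> *\<^sub>R (r' - r))
        = epi_cost D c (U, r) + \<tau> * (a + \<tau> * b)"
    proof -
      have "quad_form D (U + \<tau> *\<^sub>R (U' - U))
          = quad_form D U + 2 * \<tau> * ((D *v U) \<bullet> (U' - U)) + 2 * \<tau>\<^sup>2 * b"
        using inner_symmetric_mult[OF D, of U "U' - U"]
        by (simp only: quad_form_add[OF D] quad_form_scaleR matrix_vector_mult_scaleR
            inner_scaleR_right inner_commute[of "D *v U"] b_def)
      moreover have "(\<Sum>h\<in>UNIV. (r + \<tau> *\<^sub>R (r' - r)) $ h)
          = (\<Sum>h\<in>UNIV. r $ h) + \<tau> * (\<Sum>h\<in>UNIV. r' $ h - r $ h)"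
        by (simp only: vector_add_component vector_scaleR_component vector_minus_component
            sum.distrib sum_distrib_left real_scaleR_def)
      moreover have "c \<bullet> (U + \<tau> *\<^sub>R (U' - U)) = c \<bullet> U + \<tau> * (c \<bullet> (U' - U))"
        by (simp only: inner_add_right inner_scaleR_right)
      ultimately show ?thesis
        unfolding epi_cost_def a_def inner_add_left fst_conv snd_conv
        by (simp add: power2_eq_square distrib_left add_divide_distrib)
    qed
    ultimately show ?thesis by simp
  qed
  \<comment> \<open>Small enough for the second-order term to recover at most half of \<open>a\<close>; adding 1 to
    \<open>\<bar>b\<bar>\<close> avoids a zero denominator.\<close>
  define \<tau> where "\<tau> = min 1 (- a / (2 * (\<bar>b\<bar> + 1)))"
  have \<tau>: "0 < \<tau>" "\<tau> \<le> 1"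
    using a by (auto simp: \<tau>_def intro!: divide_neg_pos)
  have "\<tau> * b \<le> \<tau> * (\<bar>b\<bar> + 1)"
    using \<tau>(1) by (intro mult_left_mono) auto
  also have "\<dots> \<le> - a / (2 * (\<bar>b\<bar> + 1)) * (\<bar>b\<bar> + 1)"
    by (intro mult_right_mono) (auto simp: \<tau>_def)
  also have "\<dots> = - a / 2"
    by (simp add: field_simps)
  finally have "a + \<tau> * b < 0" using a by simp
  then show False
    using *[OF \<tau>] \<tau>(1) by (simp add: zero_le_mult_iff)
qed

text \<open>This is \<open>- block (c + D *v U) h \<in> \<partial> (l h) (block U h)\<close>.  The feasible set is a product over
  the stages, so a competitor may differ from the minimiser at a single stage.\<close>

lemma epi_minimizer_stage_subgradient:
  assumes min: "epi_minimizer D c l (U, r)"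
    and D: "symmetric_mat D"
    and l: "\<And>h. convex_closed_proper (l h)"
    and v: "l h v \<le> ereal \<rho>"
  shows "0 \<le> block (c + D *v U) h \<bullet> (v - block U h) + \<rho> - r $ h"
proof -
  define U' where "U' = stack (\<lambda>k. if k = h then v else block U k)"
  define r' where "r' = (\<chi> k. if k = h then \<rho> else r $ k)"
  have "(U', r') \<in> stage_epigraph l"
    using min v by (simp add: epi_minimizer_def stage_epigraph_def U'_def r'_def)
  from epi_minimizer_first_order[OF min D l this]
  have "0 \<le> (\<Sum>k\<in>UNIV. block (c + D *v U) k \<bullet> (block U' k - block U k)) + (\<Sum>k\<in>UNIV. r' $ k - r $ k)"
    by (simp only: inner_eq_sum_block block_simps)
  also have "(\<Sum>k\<in>UNIV. block (c + D *v U) k \<bullet> (block U' k - block U k))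
      = (\<Sum>k\<in>UNIV. if k = h then block (c + D *v U) h \<bullet> (v - block U h) else 0)"
    by (intro sum.cong) (simp_all add: U'_def)
  also have "(\<Sum>k\<in>UNIV. r' $ k - r $ k) = (\<Sum>k\<in>UNIV. if k = h then \<rho> - r $ h else 0)"
    by (intro sum.cong) (simp_all add: r'_def)
  finally show ?thesis by simp
qed

text \<open>Monotonicity of the subdifferential of \<open>l h\<close>: each of the two minimisers serves as the
  competitor in the other's subgradient inequality, and in the sum of the two inequalities the
  values \<open>r $ h\<close> and \<open>r' $ h\<close> cancel.\<close>

lemma stage_gradient_monotone:
  assumes min: "epi_minimizer D c l (U, r)" "epi_minimizer D c' l (U', r')"
    and D: "symmetric_mat D"
    and l: "\<And>h. convex_closed_proper (l h)"
  shows "block (U - U') h \<bullet> block ((c - c') + D *v (U - U')) h \<le> 0"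
proof -
  have "l h (block U h) \<le> ereal (r $ h)" "l h (block U' h) \<le> ereal (r' $ h)"
    using min by (auto simp: epi_minimizer_def stage_epigraph_def)
  then show ?thesis
    using epi_minimizer_stage_subgradient[OF min(1) D l, of h "block U' h" "r' $ h"]
      epi_minimizer_stage_subgradient[OF min(2) D l, of h "block U h" "r $ h"]
    by (simp add: matrix_vector_mult_diff_distrib inner_commute algebra_simps)
qed

text \<open>For equal linear terms, the stagewise inequalities add up to \<open>quad_form D (U - U') \<le> 0\<close>.\<close>

lemma epi_minimizer_unique:
  assumes min: "epi_minimizer D c l (U, r)" "epi_minimizer D c l (U', r')"
    and D: "pos_def_mat D"
    and l: "\<And>h. convex_closed_proper (l h)"
  shows "U = U'"
proof (rule ccontr)
  assume "U \<noteq> U'"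
  then have "0 < quad_form D (U - U')"
    using D by (simp add: pos_def_mat_def)
  also have "\<dots> = (\<Sum>h\<in>UNIV. block (U - U') h \<bullet> block ((c - c) + D *v (U - U')) h)"
    by (simp add: quad_form_def inner_eq_sum_block del: block_simps)
  also have "\<dots> \<le> 0"
    using D by (intro sum_nonpos stage_gradient_monotone[OF min _ l]) (simp add: pos_def_mat_def)
  finally show False by simp
qed

text \<open>A minimiser has finite cost, because some point of the product of the epigraphs bounds the
  infimum.  Its regularizers therefore have real values, and these values are the required
  \<open>r\<close>.\<close>

lemma is_arg_min_imp_epi_minimizer:
  fixes U :: "real ^ ('h::finite \<times> 'm::finite)"
  assumes F: "\<And>U. F U = ereal (k + c \<bullet> U + quad_form D U / 2) + (\<Sum>h\<in>UNIV. l h (block U h))"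
    and l: "\<And>h. convex_closed_proper (l h)"
    and U: "is_arg_min F (\<lambda>_. True) U"
  obtains r where "epi_minimizer D c l (U, r)"
proof -
  have upper: "F V \<le> ereal (k + epi_cost D c (V, r))" if "(V, r) \<in> stage_epigraph l" for V r
  proof -
    have "(\<Sum>h\<in>UNIV. l h (block V h)) \<le> (\<Sum>h\<in>UNIV. ereal (r $ h))"
      using that by (intro sum_mono) (auto simp: stage_epigraph_def)
    then have "F V \<le> ereal (k + c \<bullet> V + quad_form D V / 2) + ereal (\<Sum>h\<in>UNIV. r $ h)"
      unfolding F by (intro add_left_mono) simp
    then show ?thesis by (simp add: epi_cost_def algebra_simps)
  qed
  have min: "F U \<le> F V" for V
    using U by (simp add: is_arg_min_linorder)
  define r where "r = (\<chi> h. real_of_ereal (l h (block U h)))"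
  obtain V s where "(V, s) \<in> stage_epigraph l"
    using stage_epigraph_nonempty[OF l] by fastforce
  then have "F U \<noteq> \<infinity>"
    using upper min[of V] by (metis ereal_infty_less_eq(1) PInfty_neq_ereal(1))
  then have "l h (block U h) \<noteq> \<infinity>" for h
    unfolding F by (auto simp: sum_Pinfty)
  then have r: "l h (block U h) = ereal (r $ h)" for h
    using l[of h] by (cases "l h (block U h)") (auto simp: r_def convex_closed_proper_def)
  then have "F U = ereal (k + epi_cost D c (U, r))"
    by (simp add: F epi_cost_def algebra_simps)
  then have "epi_cost D c (U, r) \<le> epi_cost D c z" if "z \<in> stage_epigraph l" for z
    using order.trans[OF min upper] that by (cases z) auto
  moreover have "(U, r) \<in> stage_epigraph l"
    by (simp add: stage_epigraph_def r)
  ultimately show thesis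
    by (intro that[of r]) (simp add: epi_minimizer_def)
qed

lemma epi_minimizer_imp_is_arg_min:
  fixes U :: "real ^ ('h::finite \<times> 'm::finite)"
  assumes F: "\<And>U. F U = ereal (k + c \<bullet> U + quad_form D U / 2) + (\<Sum>h\<in>UNIV. l h (block U h))"
    and l: "\<And>h. convex_closed_proper (l h)"
    and min: "epi_minimizer D c l (U, r)"
  shows "is_arg_min F (\<lambda>_. True) U"
  unfolding is_arg_min_linorder
proof (intro conjI allI impI TrueI)
  fix V
  have "(\<Sum>h\<in>UNIV. l h (block U h)) \<le> (\<Sum>h\<in>UNIV. ereal (r $ h))"
    using min by (intro sum_mono) (auto simp: epi_minimizer_def stage_epigraph_def)
  then have "F U \<le> ereal (k + c \<bullet> U + quad_form D U / 2) + ereal (\<Sum>h\<in>UNIV. r $ h)"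
    unfolding F by (intro add_left_mono) simp
  then have upper: "F U \<le> ereal (k + epi_cost D c (U, r))"
    by (simp add: epi_cost_def algebra_simps)
  show "F U \<le> F V"
  proof (cases "\<exists>h. l h (block V h) = \<infinity>")
    case True
    then have "F V = \<infinity>"
      unfolding F by (auto simp: sum_Pinfty)
    then show ?thesis by simp
  next
    case False
    define s where "s = (\<chi> h. real_of_ereal (l h (block V h)))"
    have s: "l h (block V h) = ereal (s $ h)" for h
      using l[of h] False by (cases "l h (block V h)") (auto simp: s_def convex_closed_proper_def)
    then have "(V, s) \<in> stage_epigraph l"
      by (simp add: stage_epigraph_def)
    then have "epi_cost D c (U, r) \<le> epi_cost D c (V, s)"
      using min by (simp add: epi_minimizer_def)
    moreover have "F V = ereal (k + epi_cost D c (V, s))"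
      by (simp add: F s epi_cost_def algebra_simps)
    ultimately show ?thesis
      using upper by (auto intro: order.trans)
  qed
qed

lemma the_arg_min_is_epi_minimizer:
  fixes F :: "real ^ ('h::finite \<times> 'm::finite) \<Rightarrow> ereal"
  assumes F: "\<And>U. F U = ereal (k + c \<bullet> U + quad_form D U / 2) + (\<Sum>h\<in>UNIV. l h (block U h))"
    and D: "pos_def_mat D"
    and l: "\<And>h. convex_closed_proper (l h)"
  obtains r where "epi_minimizer D c l ((THE U. is_arg_min F (\<lambda>_. True) U), r)"
proof -
  obtain z0 where "epi_minimizer D c l z0"
    by (rule epi_minimizer_exists[OF D l])
  then obtain U0 r0 where U0: "epi_minimizer D c l (U0, r0)"
    by (cases z0) blast
  have "is_arg_min F (\<lambda>_. True) U0"
    by (rule epi_minimizer_imp_is_arg_min[OF F l U0])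
  moreover have "U = U0" if opt: "is_arg_min F (\<lambda>_. True) U" for U
  proof -
    obtain r where "epi_minimizer D c l (U, r)"
      by (rule is_arg_min_imp_epi_minimizer[OF F l opt])
    then show ?thesis
      by (rule epi_minimizer_unique[OF _ U0 D l])
  qed
  ultimately have "(THE U. is_arg_min F (\<lambda>_. True) U) = U0"
    by (intro the_equality)
  with U0 show thesis
    by (intro that[of r0]) simp
qed


section \<open>The matrix inequality and contraction\<close>

lemma quad_form_add_left: "quad_form (M + N) v = quad_form M v + quad_form N v"
  by (simp add: quad_form_def matrix_vector_mult_add_rdistrib inner_add_right)

lemma quad_form_sandwich: "quad_form (transpose T ** N ** T) v = quad_form N (T *v v)"
  by (simp add: quad_form_def matrix_vector_mul_assoc[symmetric] inner_transpose_mult)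

text \<open>The outer factor sends \<open>(x, U)\<close> to the pair of \<open>U\<close> and the subgradient \<open>- (C x + D U)\<close>, and
  the antidiagonal middle factor pairs these two, each product appearing twice.\<close>

lemma LMI_quad_form:
  fixes A P :: "real ^ 'n ^ 'n"
    and B :: "real ^ 'm ^ 'n"
    and C :: "real ^ 'n ^ ('h::finite \<times> 'm)"
    and D :: "real ^ ('h \<times> 'm) ^ ('h \<times> 'm)"
    and E :: "real ^ ('h \<times> 'm) ^ 'm"
    and lam :: "real ^ 'h"
  defines "Lam \<equiv> kronecker (diag_mat lam) (mat 1)"
  shows "quad_form (block_mat
         (transpose A ** P ** A - \<eta>\<^sup>2 *\<^sub>R P)     (transpose A ** P ** B ** E)
         (transpose E ** transpose B ** P ** A) (transpose E ** transpose B ** P ** B ** E)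
       + transpose (block_mat 0 (mat 1) (- C) (- D))
         ** block_mat 0 Lam Lam 0
         ** block_mat 0 (mat 1) (- C) (- D)) (join x U)
    = quad_form P (A *v x + B *v (E *v U)) - \<eta>\<^sup>2 * quad_form P x
      - 2 * (\<Sum>h\<in>UNIV. lam $ h * (block U h \<bullet> block (C *v x + D *v U) h))"
proof -
  let ?W = "C *v x + D *v U"
  have "quad_form (block_mat
         (transpose A ** P ** A - \<eta>\<^sup>2 *\<^sub>R P)     (transpose A ** P ** B ** E)
         (transpose E ** transpose B ** P ** A) (transpose E ** transpose B ** P ** B ** E)) (join x U)
    = quad_form P (A *v x + B *v (E *v U)) - \<eta>\<^sup>2 * quad_form P x"
    by (simp add: quad_form_def block_mat_mult_join inner_join matrix_vector_mul_assoc[symmetric]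
        inner_transpose_mult inner_add_left inner_add_right matrix_vector_right_distrib
        matrix_vector_mult_diff_rdistrib inner_diff_right scaleR_matrix_vector_assoc[symmetric])
  moreover have "block_mat 0 (mat 1) (- C) (- D) *v join x U = join U (- ?W)"
    by (simp add: block_mat_mult_join uminus_matrix_vector_mult)
  moreover have "U \<bullet> (Lam *v (- ?W)) = - (\<Sum>h\<in>UNIV. lam $ h * (block U h \<bullet> block ?W h))"
    unfolding Lam_def inner_kronecker_diag_mult 
    by (simp only: block_simps inner_minus_right mult_minus_right sum_negf)
  moreover have "(- ?W) \<bullet> (Lam *v U) = - (\<Sum>h\<in>UNIV. lam $ h * (block U h \<bullet> block ?W h))"
    unfolding Lam_def inner_kronecker_diag_mult
    by (simp only: block_simps(4) inner_minus_left mult_minus_right sum_negf)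
      (simp only: inner_commute)
  moreover have "quad_form (block_mat 0 Lam Lam 0) (join U (- ?W))
      = U \<bullet> (Lam *v (- ?W)) + (- ?W) \<bullet> (Lam *v U)"
    by (simp add: quad_form_def block_mat_mult_join inner_join)
  ultimately show ?thesis
    unfolding quad_form_add_left quad_form_sandwich by simp
qed


theorem theorem2:
  fixes A Q Qf P :: "real ^ 'n ^ 'n"
    and B :: "real ^ 'm ^ 'n"
    and R :: "real ^ 'm ^ 'm"
    and C :: "real ^ 'n ^ ('h::{finite,linorder} \<times> 'm)"
    and D Lam :: "real ^ ('h \<times> 'm) ^ ('h \<times> 'm)"
    and Pi1 :: "real ^ ('h \<times> 'm) ^ 'm"
    and Vreg :: "real ^ ('h \<times> 'm) \<Rightarrow> nat \<Rightarrow> ereal"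
    and lreg :: "real ^ 'm \<Rightarrow> nat \<Rightarrow> ereal"
    and lam :: "(real, 'h) vec"
    and \<eta> :: real
  assumes C: "C = C_mat A B Q Qf"
    and D: "D = D_mat A B Q Qf R"
    and Lam: "Lam = kronecker (diag_mat lam) (mat 1)"
    and Pi1: "Pi1 = first_block"
    and symmetric: "symmetric_mat Q" "symmetric_mat Qf" "symmetric_mat R"
    and D_pos_def: "pos_def_mat D"
    and Vreg: "\<And>U t. Vreg U t = (\<Sum>h\<in>UNIV. lreg (block U h) (t + stage h))"
    and lreg: "\<And>t. convex_closed_proper (\<lambda>v. lreg v t)"
    and eta: "0 < \<eta>" "\<eta> < 1"
    and P_pos_def: "pos_def_mat P"
    and lam_nonneg: "\<And>h. 0 \<le> lam $ h"
    and LMI: "neg_semidef_mat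
      (block_mat
         (transpose A ** P ** A - \<eta>\<^sup>2 *\<^sub>R P)     (transpose A ** P ** B ** Pi1)
         (transpose Pi1 ** transpose B ** P ** A) (transpose Pi1 ** transpose B ** P ** B ** Pi1)
       + transpose (block_mat 0 (mat 1) (- C) (- D))
         ** block_mat 0 Lam Lam 0
         ** block_mat 0 (mat 1) (- C) (- D))"
  shows "strongly_contracting P \<eta> (mpc_closed_loop A B Q Qf R Vreg)"
proof -
  define l where "l t h = (\<lambda>v. lreg v (t + stage h))" for t and h :: 'h
  define U where "U t x = (ocp_solution A B Q Qf R Vreg t x :: real ^ ('h \<times> 'm))" for t x
  have D_sym: "symmetric_mat D"
    using D_pos_def by (simp add: pos_def_mat_def)
  have l: "convex_closed_proper (l t h)" for t h
    unfolding l_def by (rule lreg)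
  have solution: "\<exists>r. epi_minimizer D (C *v x) (l t) (U t x, r)" for t x
  proof -
    have "ocp_cost A B Q Qf R Vreg t x V
        = ereal ((quad_form Q x + quad_form (Q_bar Q Qf :: real ^ ('h \<times> 'n) ^ ('h \<times> 'n)) (A_bar A *v x)) / 2
            + (C *v x) \<bullet> V + quad_form D V / 2) + (\<Sum>h\<in>UNIV. l t h (block V h))" for V
      unfolding ocp_cost_condensed[OF symmetric(1,2)] Vreg C D l_def ..
    from the_arg_min_is_epi_minimizer[OF this D_pos_def l] show ?thesis
      unfolding U_def ocp_solution_def by blast
  qed
  have step: "weighted_norm P (mpc_closed_loop A B Q Qf R Vreg t x - mpc_closed_loop A B Q Qf R Vreg t y)
      \<le> \<eta> * weighted_norm P (x - y)" for t x y
  proof -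
    define dx where "dx = x - y"
    define dU where "dU = U t x - U t y"
    define dx' where "dx' = mpc_closed_loop A B Q Qf R Vreg t x - mpc_closed_loop A B Q Qf R Vreg t y"
    have dx': "dx' = A *v dx + B *v (Pi1 *v dU)"
      by (simp add: dx'_def dx_def dU_def mpc_closed_loop_def U_def Pi1
          matrix_vector_mult_diff_distrib)
    obtain r s where "epi_minimizer D (C *v x) (l t) (U t x, r)"
      "epi_minimizer D (C *v y) (l t) (U t y, s)"
      using solution by blast
    then have "block dU h \<bullet> block (C *v dx + D *v dU) h \<le> 0" for h
      unfolding dx_def dU_def matrix_vector_mult_diff_distrib[of C]
      by (rule stage_gradient_monotone[OF _ _ D_sym l])
    then have "(\<Sum>h\<in>UNIV. lam $ h * (block dU h \<bullet> block (C *v dx + D *v dU) h)) \<le> 0"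
      by (intro sum_nonpos mult_nonneg_nonpos lam_nonneg)
    moreover have "quad_form P dx' - \<eta>\<^sup>2 * quad_form P dx
        - 2 * (\<Sum>h\<in>UNIV. lam $ h * (block dU h \<bullet> block (C *v dx + D *v dU) h)) \<le> 0"
      using LMI unfolding Lam dx' neg_semidef_mat_def LMI_quad_form[symmetric] by blast
    ultimately have "quad_form P dx' \<le> \<eta>\<^sup>2 * quad_form P dx"
      by linarith
    then have "sqrt (quad_form P dx') \<le> sqrt (\<eta>\<^sup>2 * quad_form P dx)"
      by (rule real_sqrt_le_mono)
    then show ?thesis
      using eta by (simp add: weighted_norm_def real_sqrt_mult dx'_def dx_def)
  qed
  show ?thesis
    unfolding strongly_contracting_def is_trajectory_def
    using P_pos_def eta step by simp
qed

end
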